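(* Every simple game with five players which is proper or strong is roughly weighted.
   Context: A simple game is $(P,W)$ with $P$ a finite set of players, $W\subseteq 2^P$ (winning coalitions) closed under supersets within $P$, $W\ne\emptyset$, $W\ne 2^P$; other coalitions are losing. It is proper if $X\in W$ implies $P\setminus X\notin W$, and strong if $X\notin W$ implies $P\setminus X\in W$. It is roughly weighted if there exist non-negative reals $w_p$ ($p\in P$) and a real $q$, not all zero, such that $\sum_{p\in X}w_p<q$ implies $X$ losing and $\sum_{p\in X}w_p>q$ implies $X$ winning. *)

theory Defs
  imports Complex_Main
begin

definition simple_game :: "'a set \<Rightarrow> 'a set set \<Rightarrow> bool" where
  "simple_game P W \<longleftrightarrow>
     finite P \<and> W \<subseteq> Pow P \<and>
     (\<forall>X Y. X \<in> W \<and> X \<subseteq> Y \<and> Y \<subseteq> P \<longrightarrow> Y \<in> W) \<and>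
     W \<noteq> {} \<and> W \<noteq> Pow P"

definition proper_game :: "'a set \<Rightarrow> 'a set set \<Rightarrow> bool" where
  "proper_game P W \<longleftrightarrow> (\<forall>X \<subseteq> P. X \<in> W \<longrightarrow> P - X \<notin> W)"

definition strong_game :: "'a set \<Rightarrow> 'a set set \<Rightarrow> bool" where
  "strong_game P W \<longleftrightarrow> (\<forall>X \<subseteq> P. X \<notin> W \<longrightarrow> P - X \<in> W)"

text \<open>
  ``Not all zero'' refers to the weights of the players together with the quota.
  Coalitions whose total weight equals the quota may be winning or losing.
\<close>

definition roughly_weighted :: "'a set \<Rightarrow> 'a set set \<Rightarrow> bool" where
  "roughly_weighted P W \<longleftrightarrow>
     (\<exists>(w :: 'a \<Rightarrow> real) (q :: real).
        (\<forall>p \<in> P. 0 \<le> w p) \<and>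
        ((\<exists>p \<in> P. w p \<noteq> 0) \<or> q \<noteq> 0) \<and>
        (\<forall>X \<subseteq> P. (\<Sum>p\<in>X. w p) < q \<longrightarrow> X \<notin> W) \<and>
        (\<forall>X \<subseteq> P. (\<Sum>p\<in>X. w p) > q \<longrightarrow> X \<in> W))"

end

theory Submission
  imports Defs
begin

text \<open>
  Passing to the dual game, whose winning coalitions are the complements of losing ones,
  exchanges proper and strong and replaces a quota \<open>q\<close> by \<open>w(P) - q\<close>. In a proper game any two
  winning coalitions meet. Hence a winning coalition \<open>A\<close> with at most two members yields the
  indicator weights of \<open>A\<close> with quota 1; a player contained in every winning coalition yields the
  indicator weights of that player with quota 1; and otherwise all coalitions of size 4 win and
  those of size 2 lose, so that unit weights with quota 3 do.
\<close>

text \<open>With weight 1 on \<open>A\<close> and 0 elsewhere, \<open>X\<close> weighs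
  \<open>card (X \<inter> A)\<close>. Coalitions meeting \<open>A\<close> in exactly
  \<open>k\<close> players sit on the quota and are left free; \<open>k > 0\<close> makes the quota
  nonzero, so the data are not all zero.\<close>

lemma roughly_weighted_indicator:
  assumes "finite P" "A \<subseteq> P" "k > 0"
    and lose: "\<And>X. X \<subseteq> P \<Longrightarrow> card (X \<inter> A) < k \<Longrightarrow> X \<notin> W"
    and win: "\<And>X. X \<subseteq> P \<Longrightarrow> card (X \<inter> A) > k \<Longrightarrow> X \<in> W"
  shows "roughly_weighted P W"
proof -
  define w :: "'a \<Rightarrow> real" where "w p = (if p \<in> A then 1 else 0)" for p
  have "(\<Sum>p\<in>X. w p) = real (card (X \<inter> A))" if "X \<subseteq> P" for X
    using finite_subset[OF that \<open>finite P\<close>] by (simp add: w_def sum.If_cases Int_def)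
  moreover have "\<forall>p\<in>P. 0 \<le> w p"
    by (simp add: w_def)
  ultimately show ?thesis
    unfolding roughly_weighted_def using lose win \<open>k > 0\<close>
    by (intro exI[of _ w] exI[of _ "real k"]) auto
qed

definition dual_game :: "'a set \<Rightarrow> 'a set set \<Rightarrow> 'a set set" where
  "dual_game P W = {X. X \<subseteq> P \<and> P - X \<notin> W}"

lemma simple_game_dual:
  assumes "simple_game P W"
  shows "simple_game P (dual_game P W)"
proof -
  from assms have fin: "finite P" and W: "W \<subseteq> Pow P" "W \<noteq> {}" "W \<noteq> Pow P"
    and mono: "\<And>X Y. X \<in> W \<Longrightarrow> X \<subseteq> Y \<Longrightarrow> Y \<subseteq> P \<Longrightarrow> Y \<in> W"
    unfolding simple_game_def by blast+
  obtain X where "X \<subseteq> P" "X \<notin> W" using W by blast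
  then have "P - X \<in> dual_game P W"
    by (simp add: dual_game_def double_diff)
  moreover obtain Y where "Y \<in> W" "Y \<subseteq> P" using W by blast
  then have "P - Y \<notin> dual_game P W"
    by (simp add: dual_game_def double_diff)
  moreover have "Y \<in> dual_game P W"
    if "X \<in> dual_game P W" "X \<subseteq> Y" "Y \<subseteq> P" for X Y
    using that mono[of "P - Y" "P - X"] by (auto simp: dual_game_def)
  ultimately show ?thesis
    unfolding simple_game_def using fin by (auto simp: dual_game_def)
qed

lemma proper_game_dual:
  assumes "strong_game P W"
  shows "proper_game P (dual_game P W)"
  using assms unfolding strong_game_def proper_game_def dual_game_def
  by (auto simp: double_diff)

text \<open>Complementation swaps winning with dual losing and turns weight above \<open>q\<close>
  into weight below \<open>sum w P - q\<close>, so the two strict conditions trade places.\<close>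

lemma roughly_weighted_dual:
  assumes "finite P" "roughly_weighted P (dual_game P W)"
  shows "roughly_weighted P W"
proof -
  obtain w :: "'a \<Rightarrow> real" and q :: real where nonneg: "\<forall>p\<in>P. 0 \<le> w p"
    and nz: "(\<exists>p\<in>P. w p \<noteq> 0) \<or> q \<noteq> 0"
    and lose: "\<forall>X\<subseteq>P. sum w X < q \<longrightarrow> X \<notin> dual_game P W"
    and win: "\<forall>X\<subseteq>P. sum w X > q \<longrightarrow> X \<in> dual_game P W"
    using assms(2) unfolding roughly_weighted_def by (elim exE conjE)
  have compl: "sum w (P - X) = sum w P - sum w X" if "X \<subseteq> P" for X
    using that assms(1) by (simp add: sum_diff)
  have "X \<notin> W" if "X \<subseteq> P" "sum w X < sum w P - q" for X
    using win[rule_format, of "P - X"] compl[of X] that by (simp add: dual_game_def double_diff)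
  moreover have "X \<in> W" if "X \<subseteq> P" "sum w X > sum w P - q" for X
    using lose[rule_format, of "P - X"] compl[of X] that by (simp add: dual_game_def double_diff)
  \<comment> \<open>If every weight vanishes, the new quota is \<open>- q\<close>, and
    \<open>q\<close> is then nonzero.\<close>
  moreover have "(\<exists>p\<in>P. w p \<noteq> 0) \<or> sum w P - q \<noteq> 0"
    using nz by (cases "\<forall>p\<in>P. w p = 0") auto
  ultimately show ?thesis
    unfolding roughly_weighted_def using nonneg
    by (intro exI[of _ w] exI[of _ "sum w P - q"]) auto
qed

lemma proper_game_roughly_weighted:
  assumes game: "simple_game P W" and "card P = 5" and "proper_game P W"
  shows "roughly_weighted P W"
proof -
  from game have fin: "finite P" and sub: "\<And>X. X \<in> W \<Longrightarrow> X \<subseteq> P"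
    and mono: "\<And>X Y. X \<in> W \<Longrightarrow> X \<subseteq> Y \<Longrightarrow> Y \<subseteq> P \<Longrightarrow> Y \<in> W"
    unfolding simple_game_def by blast+
  have meet: "X \<inter> Y \<noteq> {}" if "X \<in> W" "Y \<in> W" for X Y
  proof
    assume "X \<inter> Y = {}"
    \<comment> \<open>A coalition disjoint from \<open>X\<close> lies in the complement of
      \<open>X\<close>, which then wins by monotonicity, against properness.\<close>
    then have "P - X \<in> W" using mono[of Y "P - X"] sub that by blast
    then show False using \<open>proper_game P W\<close> sub that unfolding proper_game_def by blast
  qed
  consider (small) A where "A \<in> W" "card A \<le> 2"
    | (veto) p where "p \<in> P" "\<And>X. X \<in> W \<Longrightarrow> p \<in> X"
    | (large) "\<And>X. X \<in> W \<Longrightarrow> card X \<ge> 3" "\<And>p. p \<in> P \<Longrightarrow> \<exists>X\<in>W. p \<notin> X"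
  proof (cases "\<exists>A\<in>W. card A \<le> 2")
    case True
    then show ?thesis using small by auto
  next
    case no_small: False
    show ?thesis
    proof (cases "\<exists>p\<in>P. \<forall>X\<in>W. p \<in> X")
      case True
      then show ?thesis using veto by auto
    next
      case False
      then show ?thesis using no_small by (intro large) (auto simp: not_le Suc_le_eq)
    qed
  qed
  then show ?thesis
  proof cases
    case small
    have finA: "finite A" using small sub fin finite_subset by blast
    show ?thesis
    \<comment> \<open>Coalitions missing \<open>A\<close> lose by \<open>meet\<close>. Since
      \<open>A\<close> has at most two members, weight above 1 forces a coalition to contain all of
      \<open>A\<close>.\<close>
    proof (rule roughly_weighted_indicator[OF fin sub[OF small(1)], of 1])
      show "X \<notin> W" if "card (X \<inter> A) < 1" for X
        using that meet small(1) finA by auto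
      show "X \<in> W" if "X \<subseteq> P" "card (X \<inter> A) > 1" for X
      proof -
        have "X \<inter> A = A"
          using that small(2) finA by (intro card_seteq) auto
        then show ?thesis using mono small(1) that(1) by blast
      qed
    qed simp
  next
    case veto
    show ?thesis
    proof (rule roughly_weighted_indicator[OF fin, of "{p}" 1])
      show "X \<notin> W" if "card (X \<inter> {p}) < 1" for X
        using that veto(2) by force
      \<comment> \<open>Vacuous: no coalition weighs more than 1.\<close>
      show "X \<in> W" if "card (X \<inter> {p}) > 1" for X
        using that card_mono[of "{p}" "X \<inter> {p}"] by simp
    qed (use veto in auto)
  next
    case large
    show ?thesis
    proof (rule roughly_weighted_indicator[OF fin order.refl, of 3])
      show "X \<notin> W" if "X \<subseteq> P" "card (X \<inter> P) < 3" for X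
        using that large(1)[of X] by (auto simp: Int_absorb2)
      show "X \<in> W" if X: "X \<subseteq> P" "card (X \<inter> P) > 3" for X
      proof -
        have "card (P - X) \<le> 1"
          using X fin \<open>card P = 5\<close> by (simp add: card_Diff_subset finite_subset Int_absorb2)
        then have single: "a = b" if "a \<in> P - X" "b \<in> P - X" for a b
          using that fin by (metis card_le_Suc0_iff_eq finite_Diff One_nat_def)
        have "P \<noteq> {}" using \<open>card P = 5\<close> by auto
        \<comment> \<open>The player \<open>p\<close> is the one missing from \<open>X\<close>, or
          an arbitrary player when \<open>X\<close> is all of \<open>P\<close>.\<close>
        then obtain p where p: "p \<in> P" "P - X \<subseteq> {p}"
        proof (cases "P - X = {}")
          case True
          then show ?thesis using that \<open>P \<noteq> {}\<close> by blast
        next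
          case False
          then obtain p where "p \<in> P - X" by blast
          with single show ?thesis using that[of p] by auto
        qed
        \<comment> \<open>As \<open>p\<close> is not in every winning coalition, some winning
          \<open>Y\<close> avoids it and hence fits inside \<open>X\<close>.\<close>
        obtain Y where "Y \<in> W" "p \<notin> Y" using large(2)[OF p(1)] by blast
        moreover from this have "Y \<subseteq> X" using p(2) sub[of Y] by blast
        ultimately show ?thesis using mono X(1) by blast
      qed
    qed simp
  qed
qed

theorem theorem16:
  fixes P :: "'a set" and W :: "'a set set"
  assumes "simple_game P W"
    and "card P = 5"
    and "proper_game P W \<or> strong_game P W"
  shows "roughly_weighted P W"
  using assms(3)
proof
  assume "proper_game P W"
  then show ?thesis using assms(1,2) proper_game_roughly_weighted by blast
next
  assume "strong_game P W"
  then have "roughly_weighted P (dual_game P W)"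
    using assms(1,2) by (intro proper_game_roughly_weighted simple_game_dual proper_game_dual)
  moreover have "finite P" using assms(1) by (simp add: simple_game_def)
  ultimately show ?thesis using roughly_weighted_dual by blast
qed

end
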